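(* Let $n\ge1$ be an integer and let $f$ be analytic on the unit disk $\mathbf U$ with bounded real part $\Re f$. Then for all $z\in\mathbf U$, $$|f^{(n)}(z)|\le C_n\,(1-|z|^2)^{-n}\,\mathcal O_{n,\Re f}(\mathbf U),$$ where $$C_n=\begin{cases}\dfrac{1}{n\pi}\dfrac{((2m)!)^2}{(m!)^2}, & \text{if } n=2m-1 \text{ is odd},\\[2mm] \dfrac{n!}{\pi}\,2^{n}\max\{F(\beta):0\le\beta\le\pi\}, & \text{if } n=2m \text{ is even},\end{cases}$$ and, for $\beta\in[0,\pi]$, $$F(\beta)=\frac{2}{n}\sum_{k=1}^{n+1}\sin^{n+1}\frac{k\pi-\beta}{n+1}.$$
   Context: $\mathbf U=\{z\in\mathbb C:|z|<1\}$. For an analytic function $g$ on $\mathbf U$, $\mathcal O_{\Re g}(\mathbf U)=\sup_{\mathbf U}\Re g-\inf_{\mathbf U}\Re g$ is the oscillation of $\Re g$ on $\mathbf U$. $\mathfrak P_{n-1}$ is the set of all algebraic polynomials with complex coefficients of degree at most $n-1$, and $$\mathcal O_{n,\Re f}(\mathbf U)=\inf_{\mathcal P\in\mathfrak P_{n-1}}\mathcal O_{\Re(f-\mathcal P)}(\mathbf U).$$ *)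

theory Defs
  imports "HOL-Complex_Analysis.Complex_Analysis" "HOL-Computational_Algebra.Polynomial"
begin

abbreviation unit_disk :: "complex set" where
  "unit_disk \<equiv> ball 0 1"

(* Real-valued supremum and infimum, so meaningful only for functions that are bounded on S. *)
definition oscillation :: "('a \<Rightarrow> real) \<Rightarrow> 'a set \<Rightarrow> real" where
  "oscillation u S = (SUP z\<in>S. u z) - (INF z\<in>S. u z)"

(* Used for n \<ge> 1 and bounded Re f; polynomials are bounded on the disk, so every
   oscillation below is then a genuine one, and the infimum is over nonnegative numbers.
   The zero polynomial has degree 0 and is thus included. *)
definition poly_oscillation :: "nat \<Rightarrow> (complex \<Rightarrow> complex) \<Rightarrow> real" where
  "poly_oscillation n f =
     (INF p\<in>{p :: complex poly. degree p \<le> n - 1}.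
        oscillation (\<lambda>z. Re (f z - poly p z)) unit_disk)"

definition F :: "nat \<Rightarrow> real \<Rightarrow> real" where
  "F n \<beta> = 2 / real n * (\<Sum>k=1..n+1. sin ((real k * pi - \<beta>) / real (n + 1)) ^ (n + 1))"

(* The maximum of the continuous function F n over [0, pi], written as a supremum because
   Max is only for finite sets; F_max_attained shows that it is attained. *)
definition F_max :: "nat \<Rightarrow> real" where
  "F_max n = (SUP \<beta>\<in>{0..pi}. F n \<beta>)"

lemma F_max_attained: "\<exists>\<beta>\<in>{0..pi}. F n \<beta> = F_max n \<and> (\<forall>\<gamma>\<in>{0..pi}. F n \<gamma> \<le> F n \<beta>)"
proof -
  have "continuous_on {0..pi} (F n)"
    unfolding F_def by (intro continuous_intros) auto
  then obtain \<beta> where \<beta>: "\<beta> \<in> {0..pi}" "\<forall>\<gamma>\<in>{0..pi}. F n \<gamma> \<le> F n \<beta>"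
    using continuous_attains_sup[of "{0..pi}" "F n"] by auto
  then have "F_max n = F n \<beta>"
    unfolding F_max_def by (intro cSup_eq_maximum) auto
  with \<beta> show ?thesis by metis
qed

(* For odd n = 2m - 1 the index m is (n + 1) div 2. *)
definition C :: "nat \<Rightarrow> real" where
  "C n = (if odd n
          then let m = (n + 1) div 2 in 1 / (real n * pi) * ((fact (2 * m))\<^sup>2 / (fact m)\<^sup>2)
          else fact n / pi * 2 ^ n * F_max n)"

end

(*
  For g = f - p with deg p < n we have g^(n) = f^(n). Composing g with the Moebius map
  phi(w) = (w + z) / (1 + cnj z w) gives, by Bol's lemma,
    (1 - |z|^2)^n g^(n)(z) = D^n [(1 + cnj z w)^(n-1) g(phi(w))] at w = 0,
  and the Cauchy and Schwarz formulas turn the right-hand side into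
    (n!/pi) \<integral> Re g(phi(e^(it))) e^(-int) (1 + cnj z e^(it))^(n-1) dt
  (on slightly smaller circles). As a polynomial in cnj z this integral is largest on the unit
  circle, where it is at most sup |Re g| times the integral of |1 - e^(it)|^(n-1), that is
  2^n W with W = \<integral> sin^(n-1) over [0, pi]. Shifting g by a constant makes sup |Re g| half of the
  oscillation. The sharp bound would keep the oscillating factor and is C n / 2; dropping it costs
  a factor of at most pi/2 < 2, because the mean of F n over [0, pi] equals 2 W / pi.
*)
theory Submission
  imports Defs
begin

section \<open>Derivatives of weighted compositions: Bol's lemma\<close>

lemma higher_deriv_affine_mult:
  fixes c d :: complex
  assumes "X holomorphic_on S" "open S" "w \<in> S"
  shows "(deriv ^^ Suc n) (\<lambda>u. (c * u + d) * X u) w =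
         (c * w + d) * (deriv ^^ Suc n) X w + of_nat (Suc n) * c * (deriv ^^ n) X w"
  using \<open>w \<in> S\<close>
proof (induction n arbitrary: w)
  case 0
  have "(X has_field_derivative deriv X w) (at w)"
    using assms 0 holomorphic_derivI by blast
  then have "((\<lambda>u. (c * u + d) * X u) has_field_derivative (c * X w + (c * w + d) * deriv X w)) (at w)"
    by (auto intro!: derivative_eq_intros)
  then show ?case by (simp add: DERIV_imp_deriv algebra_simps)
next
  case (Suc n)
  have D: "((deriv ^^ k) X has_field_derivative (deriv ^^ Suc k) X w) (at w)" for k
    using assms Suc.prems has_field_derivative_higher_deriv by blast
  have "((\<lambda>w. (c * w + d) * (deriv ^^ Suc n) X w + of_nat (Suc n) * c * (deriv ^^ n) X w)
     has_field_derivative (c * (deriv ^^ Suc n) X w + (c * w + d) * (deriv ^^ Suc (Suc n)) X w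
       + of_nat (Suc n) * c * (deriv ^^ Suc n) X w)) (at w)"
    by (auto intro!: derivative_eq_intros D[of n, simplified] D[of "Suc n", simplified] simp: algebra_simps)
  then have "((deriv ^^ Suc n) (\<lambda>u. (c * u + d) * X u) has_field_derivative
      (c * (deriv ^^ Suc n) X w + (c * w + d) * (deriv ^^ Suc (Suc n)) X w
       + of_nat (Suc n) * c * (deriv ^^ Suc n) X w)) (at w)"
    by (rule has_field_derivative_transform_within_open[OF _ \<open>open S\<close> Suc.prems]) (simp only: Suc.IH)
  then show ?case
    by (simp add: DERIV_imp_deriv algebra_simps)
qed

text \<open>
  The induction multiplies \<open>(c u + d)\<^sup>k f(\<phi> u)\<close> by one more affine factor; the Leibniz rule for that
  factor has only two terms, and they combine to the derivative of the induction hypothesis.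
\<close>
lemma Bol_lemma:
  fixes c d \<Delta> :: complex
  assumes S: "open S" and T: "open T" and f: "f holomorphic_on T" and \<phi>T: "\<phi> ` S \<subseteq> T"
    and nz: "\<And>w. w \<in> S \<Longrightarrow> c * w + d \<noteq> 0"
    and d\<phi>: "\<And>w. w \<in> S \<Longrightarrow> (\<phi> has_field_derivative \<Delta> / (c * w + d)\<^sup>2) (at w)"
    and w: "w \<in> S"
  shows "(c * w + d) ^ (k + 2) * (deriv ^^ Suc k) (\<lambda>u. (c * u + d) ^ k * f (\<phi> u)) w =
         \<Delta> ^ Suc k * (deriv ^^ Suc k) f (\<phi> w)"
  using w
proof (induction k arbitrary: w)
  case 0
  have "(f has_field_derivative deriv f (\<phi> w)) (at (\<phi> w))"
    using f T \<phi>T 0 holomorphic_derivI by blast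
  from DERIV_chain2[OF this d\<phi>[OF 0]]
  have "deriv (\<lambda>u. f (\<phi> u)) w = deriv f (\<phi> w) * (\<Delta> / (c * w + d)\<^sup>2)"
    by (rule DERIV_imp_deriv)
  moreover have "(c * w + d)\<^sup>2 * (deriv f (\<phi> w) * (\<Delta> / (c * w + d)\<^sup>2)) = \<Delta> * deriv f (\<phi> w)"
    using nz[OF 0] by simp
  ultimately show ?case by (simp only: funpow.simps o_def id_apply power_0 power_Suc0_right mult_1 add_0 One_nat_def)
next
  case (Suc k)
  define X where "X = (\<lambda>u. (c * u + d) ^ k * f (\<phi> u))"
  let ?\<psi> = "c * w + d"
  have "\<phi> holomorphic_on S"
    using d\<phi> S by (auto simp: holomorphic_on_open)
  then have X: "X holomorphic_on S"
    unfolding X_def using f \<phi>T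
    by (intro holomorphic_intros holomorphic_on_compose_gen[of \<phi> S f T, unfolded o_def]) auto
  have DX: "((deriv ^^ Suc k) X has_field_derivative (deriv ^^ Suc (Suc k)) X w) (at w)"
    using X S Suc.prems has_field_derivative_higher_deriv by blast
  have "((\<lambda>w. (c * w + d) ^ (k + 2)) has_field_derivative of_nat (k + 2) * ?\<psi> ^ (k + 1) * c) (at w)"
    by (rule DERIV_cong[OF DERIV_power[of "\<lambda>w. c * w + d" c]]) (auto intro!: derivative_eq_intros)
  from DERIV_mult[OF this DX]
  have "((\<lambda>w. (c * w + d) ^ (k + 2) * (deriv ^^ Suc k) X w) has_field_derivative
     of_nat (k + 2) * ?\<psi> ^ (k + 1) * c * (deriv ^^ Suc k) X w +
     ?\<psi> ^ (k + 2) * (deriv ^^ Suc (Suc k)) X w) (at w)"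
    by (simp only: algebra_simps)
  \<comment> \<open>The induction hypothesis holds on all of the open set \<open>S\<close>, so both
    of its sides have the same derivative at \<open>w\<close>. Computing it from either side gives
    \<open>eq\<close>.\<close>
  then have 1: "((\<lambda>w. \<Delta> ^ Suc k * (deriv ^^ Suc k) f (\<phi> w)) has_field_derivative
     of_nat (k + 2) * ?\<psi> ^ (k + 1) * c * (deriv ^^ Suc k) X w +
     ?\<psi> ^ (k + 2) * (deriv ^^ Suc (Suc k)) X w) (at w)"
    by (rule has_field_derivative_transform_within_open[OF _ S Suc.prems])
       (simp only: Suc.IH X_def)
  have "((deriv ^^ Suc k) f has_field_derivative (deriv ^^ Suc (Suc k)) f (\<phi> w)) (at (\<phi> w))"
    using f T \<phi>T Suc.prems has_field_derivative_higher_deriv by blast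
  from DERIV_cmult[OF DERIV_chain2[OF this d\<phi>[OF Suc.prems]]]
  have "((\<lambda>w. \<Delta> ^ Suc k * (deriv ^^ Suc k) f (\<phi> w)) has_field_derivative
     \<Delta> ^ Suc k * ((deriv ^^ Suc (Suc k)) f (\<phi> w) * (\<Delta> / ?\<psi>\<^sup>2))) (at w)" .
  from DERIV_unique[OF 1 this]
  have eq: "of_nat (k + 2) * ?\<psi> ^ (k + 1) * c * (deriv ^^ Suc k) X w +
     ?\<psi> ^ (k + 2) * (deriv ^^ Suc (Suc k)) X w =
     \<Delta> ^ Suc k * ((deriv ^^ Suc (Suc k)) f (\<phi> w) * (\<Delta> / ?\<psi>\<^sup>2))" .
  have "(\<lambda>u. (c * u + d) ^ Suc k * f (\<phi> u)) = (\<lambda>u. (c * u + d) * X u)"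
    by (simp add: X_def mult.assoc)
  then have "?\<psi> ^ (Suc k + 2) * (deriv ^^ Suc (Suc k)) (\<lambda>u. (c * u + d) ^ Suc k * f (\<phi> u)) w
    = ?\<psi> ^ (k + 3) * (?\<psi> * (deriv ^^ Suc (Suc k)) X w + of_nat (k + 2) * c * (deriv ^^ Suc k) X w)"
    using higher_deriv_affine_mult[OF X S Suc.prems, of "Suc k" c d]
    by (simp only: add_Suc add_Suc_right numeral_2_eq_2 numeral_3_eq_3 add_0_right)
  \<comment> \<open>The two-term Leibniz expansion is the left side of \<open>eq\<close> times the
    square of \<open>c * w + d\<close>; that square then cancels the denominator in the derivative
    of the inner map.\<close>
  also have "\<dots> = ?\<psi>\<^sup>2 * (of_nat (k + 2) * ?\<psi> ^ (k + 1) * c * (deriv ^^ Suc k) X w +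
     ?\<psi> ^ (k + 2) * (deriv ^^ Suc (Suc k)) X w)"
    by (simp only: power_add power2_eq_square power3_eq_cube power_one_right algebra_simps)
  also have "\<dots> = \<Delta> ^ Suc (Suc k) * (deriv ^^ Suc (Suc k)) f (\<phi> w)"
    unfolding eq using nz[OF Suc.prems] by (simp add: field_simps)
  finally show ?case .
qed

section \<open>Cauchy and Schwarz formulas on circles inside the disk\<close>

lemma has_integral_circle_Taylor:
  fixes H :: "complex \<Rightarrow> complex"
  assumes H: "H holomorphic_on ball 0 1" and \<rho>: "0 < \<rho>" "\<rho> < 1"
  shows "((\<lambda>t. H (of_real \<rho> * cis t) * cis (- (real n * t))) has_integral
           2 * pi * of_real \<rho> ^ n / fact n * (deriv ^^ n) H 0) {0..2 * pi}"
proof -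
  have sub: "cball 0 \<rho> \<subseteq> ball (0::complex) 1" using \<rho> by auto
  have "continuous_on (cball 0 \<rho>) H" "H holomorphic_on ball 0 \<rho>"
    using H sub holomorphic_on_subset holomorphic_on_imp_continuous_on ball_subset_cball
    by (metis subset_trans)+
  then have "((\<lambda>u. H u / (u - 0) ^ Suc n) has_contour_integral
      (2 * pi * \<i>) / fact n * (deriv ^^ n) H 0) (circlepath 0 \<rho>)"
    using \<rho> by (intro Cauchy_has_contour_integral_higher_derivative_circlepath) auto
  then have "((\<lambda>t. H (of_real \<rho> * cis t) / (of_real \<rho> * cis t) ^ Suc n * \<rho> * \<i> * cis t)
      has_integral (2 * pi * \<i>) / fact n * (deriv ^^ n) H 0) {0..2 * pi}"
    unfolding circlepath_def by (subst (asm) has_contour_integral_part_circlepath_iff) auto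
  \<comment> \<open>The factor removes the \<open>\<i>\<close> of dz and the power of the radius
    that is left in the denominator.\<close>
  from has_integral_mult_right[OF this, of "of_real \<rho> ^ n / \<i>"]
  have "((\<lambda>t. of_real \<rho> ^ n / \<i> * (H (of_real \<rho> * cis t) / (of_real \<rho> * cis t) ^ Suc n * \<rho> * \<i> * cis t))
      has_integral 2 * pi * of_real \<rho> ^ n / fact n * (deriv ^^ n) H 0) {0..2 * pi}"
    by (simp add: field_simps)
  moreover have "of_real \<rho> ^ n / \<i> * (H (of_real \<rho> * cis t) / (of_real \<rho> * cis t) ^ Suc n * \<rho> * \<i> * cis t)
    = H (of_real \<rho> * cis t) * cis (- (real n * t))" for t
  proof -
    have "cis (- (real n * t)) = inverse (cis t ^ n)"
      by (metis Complex.DeMoivre cis_inverse)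
    then show ?thesis using \<rho> by (simp add: field_simps)
  qed
  ultimately show ?thesis by (simp only:)
qed

text \<open>This is the mean value property for \<open>H w * w\<close>, which vanishes at 0.\<close>

lemma has_integral_circle_holomorphic_zero:
  fixes H :: "complex \<Rightarrow> complex"
  assumes H: "H holomorphic_on ball 0 1" and \<rho>: "0 < \<rho>" "\<rho> < 1"
  shows "((\<lambda>t. H (of_real \<rho> * cis t) * cis t) has_integral 0) {0..2 * pi}"
proof -
  have "((\<lambda>t. (H (of_real \<rho> * cis t) * (of_real \<rho> * cis t)) * cis (- (real 0 * t))) has_integral
           2 * pi * of_real \<rho> ^ 0 / fact 0 * (deriv ^^ 0) (\<lambda>w. H w * w) 0) {0..2 * pi}"
    by (rule has_integral_circle_Taylor[of "\<lambda>w. H w * w"]) (use H \<rho> in \<open>auto intro!: holomorphic_intros\<close>)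
  then have "((\<lambda>t. H (of_real \<rho> * cis t) * (of_real \<rho> * cis t)) has_integral 0) {0..2 * pi}"
    by simp
  from has_integral_mult_right[OF this, of "1 / of_real \<rho>"] show ?thesis
    using \<rho> by (simp add: field_simps)
qed

text \<open>Write Re H as half the sum of H and its conjugate. The kernel contains only the
  frequencies from \<open>- Suc k\<close> to -1, so it annihilates the conjugate, whose frequencies
  are nonpositive. The H part is a Taylor coefficient of \<open>(1 + a * w) ^ k * H w\<close>; the
  halving turns 2 pi into pi.\<close>

lemma has_integral_Re_circle:
  fixes H :: "complex \<Rightarrow> complex" and a :: complex
  assumes H: "H holomorphic_on ball 0 1" and \<rho>: "0 < \<rho>" "\<rho> < 1"
  shows "((\<lambda>t. of_real (Re (H (of_real \<rho> * cis t))) * cis (- (real (Suc k) * t)) * (1 + a * of_real \<rho> * cis t) ^ k)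
           has_integral pi * of_real \<rho> ^ Suc k / fact (Suc k) * (deriv ^^ Suc k) (\<lambda>w. (1 + a * w) ^ k * H w) 0)
         {0..2 * pi}"
proof -
  let ?K = "\<lambda>t. cis (- (real (Suc k) * t)) * (1 + a * of_real \<rho> * cis t) ^ k"
  have "((\<lambda>t. (1 + a * (of_real \<rho> * cis t)) ^ k * H (of_real \<rho> * cis t) * cis (- (real (Suc k) * t))) has_integral
          2 * pi * of_real \<rho> ^ Suc k / fact (Suc k) * (deriv ^^ Suc k) (\<lambda>w. (1 + a * w) ^ k * H w) 0) {0..2 * pi}"
    by (rule has_integral_circle_Taylor[of "\<lambda>w. (1 + a * w) ^ k * H w"]) (use H \<rho> in \<open>auto intro!: holomorphic_intros\<close>)
  then have 1: "((\<lambda>t. H (of_real \<rho> * cis t) * ?K t) has_integral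
          2 * pi * of_real \<rho> ^ Suc k / fact (Suc k) * (deriv ^^ Suc k) (\<lambda>w. (1 + a * w) ^ k * H w) 0) {0..2 * pi}"
    by (simp add: mult_ac)
  \<comment> \<open>On the circle, the conjugate of the kernel is a multiple of the boundary value of a
    holomorphic function vanishing at 0.\<close>
  have "((\<lambda>t. ((of_real \<rho> * cis t / of_real \<rho> + cnj a * of_real \<rho>) ^ k * H (of_real \<rho> * cis t)) * cis t) has_integral 0) {0..2 * pi}"
    by (rule has_integral_circle_holomorphic_zero[of "\<lambda>w. (w / of_real \<rho> + cnj a * of_real \<rho>) ^ k * H w"])
       (use H \<rho> in \<open>auto intro!: holomorphic_intros\<close>)
  then have "((\<lambda>t. cnj (((of_real \<rho> * cis t / of_real \<rho> + cnj a * of_real \<rho>) ^ k * H (of_real \<rho> * cis t)) * cis t)) has_integral cnj 0) {0..2 * pi}"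
    by (subst has_integral_cnj[symmetric]) (simp add: o_def)
  moreover have "cnj (((of_real \<rho> * cis t / of_real \<rho> + cnj a * of_real \<rho>) ^ k * H (of_real \<rho> * cis t)) * cis t)
      = cnj (H (of_real \<rho> * cis t)) * ?K t" for t
  proof -
    \<comment> \<open>Of the \<open>Suc k\<close> factors \<open>cis (- t)\<close>, \<open>k\<close>
      are absorbed into the power and one stays over. After conjugation it is the factor
      \<open>cis t\<close> that makes the integral vanish.\<close>
    have "cis (- (real (Suc k) * t)) = cis (- t) * cis (-t) ^ k"
      using Complex.DeMoivre[of "- t" "Suc k"] by (simp only: mult_minus_right power_Suc)
    moreover have "cis (- t) ^ k * (1 + a * of_real \<rho> * cis t) ^ k = (cis (-t) + a * of_real \<rho>) ^ k"
    proof -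
      have "cis (- t) * (1 + a * of_real \<rho> * cis t) = cis (- t) + a * of_real \<rho> * (cis (- t) * cis t)"
        by (simp add: distrib_left mult_ac)
      then show ?thesis by (simp add: power_mult_distrib[symmetric] cis_mult)
    qed
    ultimately show ?thesis
      using \<rho> by (simp add: cis_cnj algebra_simps)
  qed
  ultimately have 2: "((\<lambda>t. cnj (H (of_real \<rho> * cis t)) * ?K t) has_integral 0) {0..2 * pi}"
    by (simp only: complex_cnj_zero)
  have "((\<lambda>t. (H (of_real \<rho> * cis t) * ?K t + cnj (H (of_real \<rho> * cis t)) * ?K t) / 2) has_integral
     (2 * pi * of_real \<rho> ^ Suc k / fact (Suc k) * (deriv ^^ Suc k) (\<lambda>w. (1 + a * w) ^ k * H w) 0 + 0) / 2) {0..2 * pi}"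
    by (intro has_integral_divide has_integral_add 1 2)
  moreover have "(H (of_real \<rho> * cis t) * ?K t + cnj (H (of_real \<rho> * cis t)) * ?K t) / 2
     = of_real (Re (H (of_real \<rho> * cis t))) * cis (- (real (Suc k) * t)) * (1 + a * of_real \<rho> * cis t) ^ k" for t
  proof -
    have "of_real (Re (H (of_real \<rho> * cis t))) = (H (of_real \<rho> * cis t) + cnj (H (of_real \<rho> * cis t))) / 2"
      by (simp add: complex_add_cnj)
    then show ?thesis by (simp only:) (simp add: algebra_simps)
  qed
  moreover have "(2 * x + 0) / 2 = x" for x :: complex by simp
  ultimately show ?thesis by (simp only: mult.assoc times_divide_eq_left) (simp add: mult.assoc)
qed

section \<open>Wallis integrals and the norm of the extremal kernel\<close>

definition sin_moment :: "nat \<Rightarrow> real" where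
  "sin_moment k = integral {0..pi} (\<lambda>x. sin x ^ k)"

lemma has_integral_sin_moment: "((\<lambda>x. sin x ^ k) has_integral sin_moment k) {0..pi}"
  unfolding sin_moment_def
  by (intro integrable_integral integrable_continuous_real continuous_intros)

lemma sin_moment_nonneg: "0 \<le> sin_moment k"
  by (rule has_integral_nonneg[OF has_integral_sin_moment]) (simp add: sin_ge_zero)

text \<open>Wallis recurrence: the difference of the two integrands is the derivative of
  \<open>- cos x * sin x ^ (k + 1)\<close>, which vanishes at both ends.\<close>

lemma sin_moment_Suc_Suc: "real (k + 2) * sin_moment (k + 2) = real (k + 1) * sin_moment k"
proof -
  have "((\<lambda>x. real (k + 2) * sin x ^ (k + 2) - real (k + 1) * sin x ^ k) has_integral
      (- cos pi * sin pi ^ (k + 1)) - (- cos 0 * sin 0 ^ (k + 1))) {0..pi}"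
  proof (rule fundamental_theorem_of_calculus)
    fix x :: real
    have "((\<lambda>x. - cos x * sin x ^ (k + 1)) has_real_derivative
       real (k + 2) * sin x ^ (k + 2) - real (k + 1) * sin x ^ k) (at x)"
    proof -
      have c2: "cos x * cos x = 1 - sin x * sin x"
        using sin_cos_squared_add[of x] by (simp add: power2_eq_square)
      have "real (k + 2) * sin x ^ (k + 2) - real (k + 1) * sin x ^ k
          = sin x * sin x ^ (k + 1) - real (k + 1) * sin x ^ k * (cos x * cos x)"
        unfolding c2 by (simp add: algebra_simps)
      moreover have "((\<lambda>x. - cos x * sin x ^ (k + 1)) has_real_derivative
          sin x * sin x ^ (k + 1) - real (k + 1) * sin x ^ k * (cos x * cos x)) (at x)"
        by (rule DERIV_cong[OF DERIV_mult[OF DERIV_minus[OF DERIV_cos] DERIV_power[OF DERIV_sin, of "k + 1"]]])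
           (simp add: algebra_simps)
      ultimately show ?thesis by (simp only:)
    qed
    then show "((\<lambda>x. - cos x * sin x ^ (k + 1)) has_vector_derivative
       real (k + 2) * sin x ^ (k + 2) - real (k + 1) * sin x ^ k) (at x within {0..pi})"
      by (simp add: has_real_derivative_iff_has_vector_derivative has_vector_derivative_at_within)
  qed simp
  moreover have "((\<lambda>x. real (k + 2) * sin x ^ (k + 2) - real (k + 1) * sin x ^ k) has_integral
      real (k + 2) * sin_moment (k + 2) - real (k + 1) * sin_moment k) {0..pi}"
    by (intro has_integral_diff has_integral_mult_right has_integral_sin_moment)
  ultimately have "real (k + 2) * sin_moment (k + 2) - real (k + 1) * sin_moment k =
      (- cos pi * sin pi ^ (k + 1)) - (- cos 0 * sin 0 ^ (k + 1))"
    by (rule has_integral_unique[rotated])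
  then show ?thesis by simp
qed

lemma norm_one_minus_cis: "norm (1 - cis t) = 2 * \<bar>sin (t / 2)\<bar>"
proof -
  have "(norm (1 - cis t))\<^sup>2 = (1 - cos t)\<^sup>2 + (sin t)\<^sup>2"
    by (simp add: cmod_power2)
  also have "\<dots> = (2 * \<bar>sin (t / 2)\<bar>)\<^sup>2"
    using cos_double_sin[of "t/2"] sin_cos_squared_add[of t] by (simp add: power2_eq_square algebra_simps)
  finally show ?thesis by (rule power2_eq_imp_eq) auto
qed

text \<open>The interval is cut at \<open>s\<close>. Shifting back by \<open>s\<close>, and adding
  one period on the first piece, sends the pieces to \<open>{T - s..T}\<close> and
  \<open>{0..T - s}\<close>.\<close>

lemma integral_shift_periodic:
  fixes f :: "real \<Rightarrow> 'a::banach"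
  assumes f: "continuous_on UNIV f" and per: "\<And>x. f (x + T) = f x" and s: "0 \<le> s" "s \<le> T"
  shows "integral {0..T} (\<lambda>x. f (x - s)) = integral {0..T} f"
proof -
  have i: "f integrable_on {a..b}" for a b
    by (rule integrable_continuous_real) (use f continuous_on_subset in blast)
  have shift: "integral {a..b} (\<lambda>x. f (x + c)) = integral {a + c..b + c} f" for a b c
    using has_integral_affinity'[OF integrable_integral[OF i[of "a + c" "b + c"], folded cbox_interval], of 1 c]
    by (simp add: integral_unique)
  have "continuous_on UNIV (\<lambda>x. f (x - s))"
    by (rule continuous_on_compose2[OF f]) (auto intro: continuous_intros)
  then have i': "(\<lambda>x. f (x - s)) integrable_on {0..T}"
    using integrable_continuous_real continuous_on_subset by blast
  have "integral {0..T} (\<lambda>x. f (x - s)) = integral {0..s} (\<lambda>x. f (x - s)) + integral {s..T} (\<lambda>x. f (x - s))"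
    using Henstock_Kurzweil_Integration.integral_combine[OF s i'] by simp
  also have "integral {0..s} (\<lambda>x. f (x - s)) = integral {0..s} (\<lambda>x. f (x + (T - s)))"
    using per[of "_ - s"] by (simp add: algebra_simps)
  also have "\<dots> = integral {T - s..T} f" by (simp add: shift)
  also have "integral {s..T} (\<lambda>x. f (x - s)) = integral {0..T - s} f"
    using shift[of s T "- s"] by simp
  also have "integral {T - s..T} f + integral {0..T - s} f = integral {0..T} f"
    using Henstock_Kurzweil_Integration.integral_combine[OF _ _ i, of 0 "T - s" T] s by (simp add: add.commute)
  finally show ?thesis .
qed

text \<open>Substitute t = 2x in the half-angle formula: \<open>2 ^ k\<close> comes from the modulus
  and one more 2 from the substitution.\<close>

lemma integral_norm_one_minus_cis:
  "integral {0..2 * pi} (\<lambda>t. norm (1 - cis t) ^ k) = 2 ^ Suc k * sin_moment k"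
proof -
  have "((\<lambda>t. 2 ^ k * sin (t / 2) ^ k) has_integral 2 ^ k * (2 * sin_moment k)) {0..2 * pi}"
    using has_integral_mult_right[OF has_integral_affinity'[OF has_integral_sin_moment[of k, folded cbox_interval], of "1/2" 0], of "2 ^ k"]
    by (simp add: field_simps)
  moreover have "norm (1 - cis t) ^ k = 2 ^ k * sin (t / 2) ^ k" if "t \<in> {0..2 * pi}" for t
    using that sin_ge_zero[of "t / 2"] by (simp add: norm_one_minus_cis power_mult_distrib)
  ultimately have "((\<lambda>t. norm (1 - cis t) ^ k) has_integral 2 ^ k * (2 * sin_moment k)) {0..2 * pi}"
    by (subst has_integral_cong) auto
  then show ?thesis by (simp add: integral_unique)
qed

lemma norm_integral_kernel_le:
  fixes K :: "real \<Rightarrow> complex" and a :: complex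
  assumes K: "continuous_on {0..2 * pi} K" and M: "\<And>t. t \<in> {0..2 * pi} \<Longrightarrow> norm (K t) \<le> M"
    and a: "norm a \<le> 1"
  shows "norm (integral {0..2 * pi} (\<lambda>t. K t * (1 + a * cis t) ^ k)) \<le> M * 2 ^ Suc k * sin_moment k"
proof -
  define Q where "Q = (\<lambda>a. integral {0..2 * pi} (\<lambda>t. K t * (1 + a * cis t) ^ k))"
  \<comment> \<open>The binomial expansion shows that \<open>Q\<close> is a polynomial in
    \<open>a\<close>, hence holomorphic, as the maximum principle requires.\<close>
  have Q: "Q = (\<lambda>a. \<Sum>j\<le>k. of_nat (k choose j) * a ^ j * integral {0..2 * pi} (\<lambda>t. K t * cis t ^ j))"
  proof
    fix a :: complex
    have "K t * (1 + a * cis t) ^ k = (\<Sum>j\<le>k. (of_nat (k choose j) * a ^ j) * (K t * cis t ^ j))" for t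
      using binomial_ring[of "a * cis t" 1 k]
      by (simp add: add.commute sum_distrib_left power_mult_distrib mult_ac)
    then show "Q a = (\<Sum>j\<le>k. of_nat (k choose j) * a ^ j * integral {0..2 * pi} (\<lambda>t. K t * cis t ^ j))"
      unfolding Q_def
      by (simp only:) (subst integral_sum;
        auto intro!: integrable_continuous_real continuous_intros K simp: integral_mult_right)
  qed
  have hol: "Q holomorphic_on S" for S
    unfolding Q by (intro holomorphic_intros)
  \<comment> \<open>By the maximum principle it suffices to consider \<open>\<bar>a\<bar> = 1\<close>, where \<open>a\<close> is absorbed in a
    rotation of the circle.\<close>
  have "norm (Q a) \<le> M * 2 ^ Suc k * sin_moment k"
  proof (rule maximum_modulus_frontier[of Q "cball 0 1"])
    show "a \<in> cball 0 1" using a by simp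
    fix b :: complex assume "b \<in> frontier (cball 0 1)"
    then have b: "norm b = 1" by (simp add: frontier_cball)
    \<comment> \<open>The angle is chosen to give \<open>b = - cis (- s)\<close>, so that
      \<open>b * cis t\<close> is \<open>- cis (t - s)\<close>. \<open>Arg2pi\<close> places it
      within one period, as the shift lemma demands.\<close>
    define s where "s = Arg2pi (- cnj b)"
    have s: "0 \<le> s" "s \<le> 2 * pi" using Arg2pi_lt_2pi[of "- cnj b"] Arg2pi_ge_0 by (auto simp: s_def)
    have "- cnj b = cis s"
      using b Arg2pi_eq[of "- cnj b"] by (simp add: s_def cis_conv_exp mult.commute)
    then have "b = - cis (- s)" by (metis cis_cnj complex_cnj_cnj complex_cnj_minus minus_minus)
    then have eq: "1 + b * cis t = 1 - cis (t - s)" for t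
      by (simp add: cis_mult add.commute)
    have "norm (Q b) \<le> integral {0..2 * pi} (\<lambda>t. M * norm (1 - cis (t - s)) ^ k)"
      unfolding Q_def eq
      by (rule integral_norm_bound_integral)
         (auto intro!: integrable_continuous_real continuous_intros K mult_right_mono M
           simp: norm_mult norm_power simp del: norm_one_minus_cis)
    also have "\<dots> = M * integral {0..2 * pi} (\<lambda>t. norm (1 - cis (t - s)) ^ k)"
      by simp
    also have "integral {0..2 * pi} (\<lambda>t. norm (1 - cis (t - s)) ^ k) = integral {0..2 * pi} (\<lambda>t. norm (1 - cis t) ^ k)"
      by (rule integral_shift_periodic[of "\<lambda>t. norm (1 - cis t) ^ k"])
         (use s in \<open>auto intro!: continuous_intros simp: cis.ctr\<close>)
    finally show "norm (Q b) \<le> M * 2 ^ Suc k * sin_moment k"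
      by (simp add: integral_norm_one_minus_cis)
  qed (use hol holomorphic_on_imp_continuous_on in auto)
  then show ?thesis by (simp add: Q_def)
qed

section \<open>Comparison of the Wallis integrals with the constant \<open>C n\<close>\<close>

text \<open>With N = n + 1, the k-th summand integrates to N times the integral of
  \<open>sin x ^ N\<close> from (k - 1) pi / N to k pi / N. These intervals tile
  \<open>{0..pi}\<close>, so the sum gives \<open>N * sin_moment N\<close>, which the Wallis
  recurrence turns into \<open>n * sin_moment (n - 1)\<close>.\<close>

lemma has_integral_F:
  assumes "n \<ge> 1"
  shows "(F n has_integral 2 * sin_moment (n - 1)) {0..pi}"
proof -
  define N where "N = n + 1"
  have N: "N > 0" by (simp add: N_def)
  \<comment> \<open>The interval contains \<open>{0..pi}\<close> in its interior, so the
    antiderivative has two-sided derivatives at 0 and pi as well.\<close>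
  have cont: "continuous_on {-1..4} (\<lambda>x. sin x ^ N :: real)"
    by (intro continuous_intros)
  obtain G where G: "\<And>x. x \<in> {-1..4} \<Longrightarrow>
      (G has_vector_derivative (sin x ^ N :: real)) (at x within {-1..4})"
    using antiderivative_continuous[OF cont] by blast
  have G': "(G has_real_derivative sin x ^ N) (at x)" if "x \<in> {0..pi}" for x
  proof -
    have x: "- 1 < x" "x < 4" using that pi_less_4 by auto
    then have "at x within {-1..4} = at x" by (intro at_within_interior) simp
    with G[of x] x show ?thesis by (simp add: has_real_derivative_iff_has_vector_derivative)
  qed
  have "((\<lambda>x. sin x ^ N) has_integral G pi - G 0) {0..pi}"
    by (rule fundamental_theorem_of_calculus)
       (simp_all add: has_vector_derivative_at_within G'[unfolded has_real_derivative_iff_has_vector_derivative])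
  then have GW: "G pi - G 0 = sin_moment N"
    using has_integral_sin_moment has_integral_unique by blast
  have summand: "((\<lambda>\<beta>. sin ((real k * pi - \<beta>) / real N) ^ N) has_integral
      real N * (G (real k * pi / real N) - G (real (k - 1) * pi / real N))) {0..pi}"
    if k: "k \<in> {1..N}" for k
  proof -
    have "((\<lambda>\<beta>. sin ((real k * pi - \<beta>) / real N) ^ N) has_integral
      (- real N * G ((real k * pi - pi) / real N)) - (- real N * G ((real k * pi - 0) / real N))) {0..pi}"
    proof (rule fundamental_theorem_of_calculus)
      fix \<beta> assume \<beta>: "\<beta> \<in> {0..pi}"
      have "\<beta> \<le> real k * pi"
      proof -
        have "1 * pi \<le> real k * pi" using k by (intro mult_right_mono) auto
        then show ?thesis using \<beta> unfolding atLeastAtMost_iff by linarith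
      qed
      moreover have "real k * pi \<le> pi * real N" using k by simp
      ultimately have "0 \<le> real k * pi - \<beta>" "real k * pi - \<beta> \<le> pi * real N"
        using \<beta> unfolding atLeastAtMost_iff by linarith+
      then have "(real k * pi - \<beta>) / real N \<in> {0..pi}"
        using N by (simp add: pos_divide_le_eq)
      from G'[OF this] have "((\<lambda>\<beta>. - real N * G ((real k * pi - \<beta>) / real N)) has_real_derivative
        - real N * (sin ((real k * pi - \<beta>) / real N) ^ N * (- 1 / real N))) (at \<beta>)"
        by (intro DERIV_cmult DERIV_chain2[of G]) (use N in \<open>auto intro!: derivative_eq_intros\<close>)
      then show "((\<lambda>\<beta>. - real N * G ((real k * pi - \<beta>) / real N)) has_vector_derivative
         sin ((real k * pi - \<beta>) / real N) ^ N) (at \<beta> within {0..pi})"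
        using N by (simp add: has_real_derivative_iff_has_vector_derivative has_vector_derivative_at_within)
    qed simp
    moreover have "real k * pi - pi = real (k - 1) * pi" using k by (simp add: algebra_simps of_nat_diff)
    ultimately show ?thesis by (simp add: algebra_simps)
  qed
  have tel: "(\<Sum>k=1..m. G (real k * pi / real N) - G (real (k - 1) * pi / real N)) =
      G (real m * pi / real N) - G 0" for m
    by (induction m) auto
  have "(F n has_integral 2 / real n * (\<Sum>k=1..N. real N * (G (real k * pi / real N) - G (real (k - 1) * pi / real N)))) {0..pi}"
    unfolding F_def N_def[symmetric] by (intro has_integral_mult_right has_integral_sum summand) auto
  also have "2 / real n * (\<Sum>k=1..N. real N * (G (real k * pi / real N) - G (real (k - 1) * pi / real N)))
      = 2 / real n * (real N * sin_moment N)"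
    unfolding sum_distrib_left[symmetric] tel using N GW by simp
  also have "\<dots> = 2 * sin_moment (n - 1)"
    using sin_moment_Suc_Suc[of "n - 1"] assms by (simp add: N_def)
  finally show ?thesis .
qed

text \<open>The mean of \<open>F n\<close> over \<open>{0..pi}\<close> is at most its
  maximum.\<close>

lemma sin_moment_le_F_max:
  assumes "n \<ge> 1"
  shows "2 * sin_moment (n - 1) \<le> pi * F_max n"
proof -
  have "F n \<beta> \<le> F_max n" if "\<beta> \<in> {0..pi}" for \<beta>
    using F_max_attained[of n] that by force
  then have "2 * sin_moment (n - 1) \<le> F_max n * (pi - 0)"
    using has_integral_le[OF has_integral_F[OF assms], of "\<lambda>_. F_max n" "F_max n * (pi - 0)"]
      has_integral_const_real[of "F_max n" 0 pi] by (simp add: mult.commute)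
  then show ?thesis by (simp add: mult.commute)
qed

text \<open>After scaling by \<open>4 ^ m\<close>, the Wallis recurrence becomes the recurrence of
  the central binomial coefficients.\<close>

lemma sin_moment_even: "4 ^ m * sin_moment (2 * m) = pi * real (2 * m choose m)"
proof (induction m)
  case 0
  show ?case by (simp add: sin_moment_def)
next
  case (Suc m)
  have "real (Suc m) * (4 ^ Suc m * sin_moment (2 * Suc m)) = 2 * 4 ^ m * (real (2 * m + 2) * sin_moment (2 * m + 2))"
    by (simp add: algebra_simps)
  also have "\<dots> = 2 * real (2 * m + 1) * (4 ^ m * sin_moment (2 * m))"
    using sin_moment_Suc_Suc[of "2 * m"] by simp
  also have "\<dots> = 2 * real (2 * m + 1) * (pi * real (2 * m choose m))" using Suc.IH by simp
  also have "\<dots> = real (Suc m) * (pi * real (2 * Suc m choose Suc m))"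
  proof -
    have "Suc m * (2 * Suc m choose Suc m) = 2 * (2 * m + 1) * (2 * m choose m)"
    proof -
      have "Suc m * (2 * Suc m choose Suc m) = 2 * (Suc m * (Suc (2 * m) choose m))"
        using Suc_times_binomial_eq[of "Suc (2 * m)" m] by (simp add: algebra_simps)
      also have "Suc (2 * m) choose m = Suc (2 * m) choose Suc m"
        using binomial_symmetric[of m "Suc (2 * m)"] by simp
      also have "Suc m * (Suc (2 * m) choose Suc m) = Suc (2 * m) * (2 * m choose m)"
        using Suc_times_binomial_eq[of "2 * m" m] by (simp add: algebra_simps)
      finally show ?thesis by simp
    qed
    then have "real (Suc m) * real (2 * Suc m choose Suc m) = 2 * real (2 * m + 1) * real (2 * m choose m)"
      by (metis of_nat_mult of_nat_numeral)
    then show ?thesis by simp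
  qed
  finally show ?case by simp
qed

text \<open>The left side is pi times the constant that the integral estimate yields. In both
  parities it is at most pi/4 times the right side, so \<open>pi < 4\<close> suffices.\<close>

lemma sin_moment_le_C:
  assumes "n \<ge> 1"
  shows "fact n * 2 ^ (n - 1) * sin_moment (n - 1) \<le> pi * C n"
proof (cases "odd n")
  case True
  then obtain j where j: "n = 2 * j + 1" by (rule oddE)
  have "fact n * 2 ^ (n - 1) * sin_moment (n - 1) = fact n * (4 ^ j * sin_moment (2 * j))"
    by (simp add: j power_mult)
  also have "\<dots> = pi * (fact n * real (2 * j choose j))"
    by (simp add: sin_moment_even)
  \<comment> \<open>The 4 is forced: \<open>4 * (fact n * real (2 * j choose j))\<close> equals
    \<open>pi * C n\<close> for n = 2j + 1.\<close>
  also have "\<dots> \<le> 4 * (fact n * real (2 * j choose j))"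
    using pi_less_4 by (intro mult_right_mono) auto
  also have "\<dots> = (fact (2 * Suc j))\<^sup>2 / (real n * (fact (Suc j))\<^sup>2)"
    by (simp add: j binomial_fact power2_eq_square divide_simps) (simp add: algebra_simps)
  also have "\<dots> = pi * C n"
    using True by (simp add: C_def Let_def j)
  finally show ?thesis .
next
  case False
  have "fact n * 2 ^ (n - 1) * sin_moment (n - 1) = fact n * 2 ^ (n - 1) / 2 * (2 * sin_moment (n - 1))"
    by simp
  also have "\<dots> \<le> fact n * 2 ^ (n - 1) / 2 * (pi * F_max n)"
    by (intro mult_left_mono sin_moment_le_F_max assms) auto
  also have "\<dots> = fact n * 2 ^ n * (pi / 4 * F_max n)"
    using assms by (cases n) auto
  also have "\<dots> \<le> fact n * 2 ^ n * F_max n"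
  proof (intro mult_left_mono)
    have "0 \<le> pi * F_max n"
      using sin_moment_le_F_max[OF assms] sin_moment_nonneg[of "n - 1"] by linarith
    then have "0 \<le> F_max n" by (metis pi_gt_zero zero_le_mult_iff not_le)
    then show "pi / 4 * F_max n \<le> F_max n"
      using pi_less_4 mult_right_mono[of "pi / 4" 1 "F_max n"] by simp
  qed auto
  also have "\<dots> = pi * C n"
    using False by (simp add: C_def)
  finally show ?thesis .
qed

section \<open>Derivative estimates for functions with bounded real part\<close>

text \<open>\<open>H\<close> is controlled only in the open disk, so the integral formula is used on
  circles of radius \<open>\<rho>\<close> < 1, and \<open>\<rho>\<close> tends to 1 at the
  end.\<close>

lemma norm_higher_deriv_weighted_le:
  fixes H :: "complex \<Rightarrow> complex" and a :: complex
  assumes H: "H holomorphic_on ball 0 1" and M: "\<And>w. w \<in> ball 0 1 \<Longrightarrow> \<bar>Re (H w)\<bar> \<le> M"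
    and a: "norm a \<le> 1"
  shows "norm ((deriv ^^ Suc k) (\<lambda>w. (1 + a * w) ^ k * H w) 0) \<le>
         fact (Suc k) / pi * (M * 2 ^ Suc k * sin_moment k)" (is "norm ?D \<le> _ * ?B")
proof -
  have le: "pi * \<rho> ^ Suc k / fact (Suc k) * norm ?D \<le> ?B" if \<rho>: "0 < \<rho>" "\<rho> < 1" for \<rho> :: real
  proof -
    define K where "K = (\<lambda>t. complex_of_real (Re (H (of_real \<rho> * cis t))) * cis (- (real (Suc k) * t)))"
    have in_ball: "of_real \<rho> * cis t \<in> ball 0 1" for t
      using \<rho> by (simp add: norm_mult)
    have "continuous_on {0..2 * pi} (\<lambda>t. H (of_real \<rho> * cis t))"
      by (rule continuous_on_compose2[OF holomorphic_on_imp_continuous_on[OF H]])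
         (use in_ball in \<open>auto intro!: continuous_intros\<close>)
    then have K: "continuous_on {0..2 * pi} K"
      unfolding K_def by (intro continuous_intros)
    \<comment> \<open>The radius is absorbed into the parameter of the kernel, which stays in the
      closed unit disk, so the kernel bound does not depend on \<open>\<rho>\<close>.\<close>
    have "norm (a * of_real \<rho>) \<le> 1"
      using a \<rho> mult_mono[of "norm a" 1 \<rho> 1] by (simp add: norm_mult)
    then have "norm (integral {0..2 * pi} (\<lambda>t. K t * (1 + (a * of_real \<rho>) * cis t) ^ k)) \<le> ?B"
      by (intro norm_integral_kernel_le[OF K]) (use M[OF in_ball] in \<open>auto simp: K_def norm_mult\<close>)
    also have "integral {0..2 * pi} (\<lambda>t. K t * (1 + (a * of_real \<rho>) * cis t) ^ k) =
        pi * of_real \<rho> ^ Suc k / fact (Suc k) * ?D"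
      using has_integral_Re_circle[OF H \<rho>, of k a] unfolding K_def by (rule integral_unique)
    finally show ?thesis
      using \<rho> by (simp add: norm_mult norm_divide norm_power del: fact_Suc funpow.simps)
  qed
  have "pi * 1 ^ Suc k / fact (Suc k) * norm ?D \<le> ?B"
  proof (rule tendsto_upperbound)
    show "((\<lambda>\<rho>. pi * \<rho> ^ Suc k / fact (Suc k) * norm ?D) \<longlongrightarrow> pi * 1 ^ Suc k / fact (Suc k) * norm ?D) (at_left 1)"
      by (intro tendsto_intros) auto
    show "\<forall>\<^sub>F \<rho> in at_left 1. pi * \<rho> ^ Suc k / fact (Suc k) * norm ?D \<le> ?B"
      using eventually_at_left_real[of 0 "1::real"] by (rule eventually_mono) (use le in auto)
  qed simp
  then show ?thesis
    by (simp add: field_simps del: fact_Suc funpow.simps power_Suc)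
qed

text \<open>The disk automorphism taking 0 to \<open>z\<close> reduces the claim to the weighted
  estimate at 0, since composing with it preserves the bound \<open>M\<close> on the real
  part.\<close>

lemma norm_higher_deriv_disk_le:
  assumes f: "f holomorphic_on ball 0 1" and M: "\<And>w. w \<in> ball 0 1 \<Longrightarrow> \<bar>Re (f w)\<bar> \<le> M"
    and z: "norm z < 1"
  shows "(1 - (norm z)\<^sup>2) ^ Suc k * norm ((deriv ^^ Suc k) f z) \<le>
         fact (Suc k) / pi * (M * 2 ^ Suc k * sin_moment k)"
proof -
  define \<phi> where "\<phi> = Moebius_function 0 (- z)"
  have \<phi>: "\<phi> = (\<lambda>w. (w + z) / (cnj z * w + 1))"
    by (simp add: \<phi>_def Moebius_function_def fun_eq_iff add.commute)
  have \<phi>_ball: "\<phi> ` ball 0 1 \<subseteq> ball 0 1"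
    using z Moebius_function_norm_lt_1[of "- z"] by (auto simp: \<phi>_def)
  have nz: "cnj z * w + 1 \<noteq> 0" if "w \<in> ball 0 1" for w
  proof
    assume "cnj z * w + 1 = 0"
    then have "norm (cnj z * w) = 1" by (metis add_eq_0_iff2 norm_minus_cancel norm_one)
    moreover have "norm (cnj z * w) < 1 * 1"
      unfolding norm_mult using z that by (intro mult_strict_mono') auto
    ultimately show False by simp
  qed
  define \<Delta> where "\<Delta> = complex_of_real (1 - (norm z)\<^sup>2)"
  have \<Delta>: "\<Delta> = 1 - z * cnj z"
    by (simp only: \<Delta>_def of_real_diff of_real_1 complex_norm_square)
  have d\<phi>: "(\<phi> has_field_derivative \<Delta> / (cnj z * w + 1)\<^sup>2) (at w)" if "w \<in> ball 0 1" for w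
    unfolding \<phi> \<Delta> using nz[OF that]
    by (auto intro!: derivative_eq_intros simp: divide_simps power2_eq_square algebra_simps)
  have H: "(\<lambda>w. f (\<phi> w)) holomorphic_on ball 0 1"
  proof -
    have "\<phi> holomorphic_on ball 0 1"
      unfolding holomorphic_on_open[OF open_ball] using d\<phi> by blast
    from holomorphic_on_compose_gen[OF this f \<phi>_ball] show ?thesis
      by (simp only: o_def)
  qed
  \<comment> \<open>At 0 the denominator \<open>cnj z * w + 1\<close> equals 1, so the prefactor in
    Bol's lemma disappears.\<close>
  have "(deriv ^^ Suc k) (\<lambda>w. (1 + cnj z * w) ^ k * f (\<phi> w)) 0 = \<Delta> ^ Suc k * (deriv ^^ Suc k) f z"
    using Bol_lemma[OF open_ball open_ball f \<phi>_ball nz d\<phi>, of 0 k] by (simp add: \<phi> add.commute)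
  moreover have "norm ((deriv ^^ Suc k) (\<lambda>w. (1 + cnj z * w) ^ k * f (\<phi> w)) 0) \<le>
      fact (Suc k) / pi * (M * 2 ^ Suc k * sin_moment k)"
    by (rule norm_higher_deriv_weighted_le[OF H]) (use M \<phi>_ball z in \<open>auto simp: image_subset_iff\<close>)
  moreover have "norm \<Delta> = 1 - (norm z)\<^sup>2"
    unfolding \<Delta>_def norm_of_real using z by (simp add: abs_square_le_1)
  ultimately show ?thesis
    by (simp only: norm_mult norm_power)
qed

section \<open>Passage to polynomial approximation and oscillation\<close>

lemma higher_deriv_poly: "(deriv ^^ k) (poly p) = poly ((pderiv ^^ k) p)" for p :: "complex poly"
proof (induction k)
  case (Suc k)
  have "deriv (poly q) = poly (pderiv q)" for q :: "complex poly"
    by (intro ext DERIV_imp_deriv poly_DERIV)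
  with Suc show ?case by simp
qed simp

lemma higher_pderiv_eq_0:
  fixes p :: "'a :: {comm_semiring_1,semiring_no_zero_divisors,semiring_char_0} poly"
  shows "degree p < k \<Longrightarrow> (pderiv ^^ k) p = 0"
proof (induction k arbitrary: p)
  case (Suc k)
  show ?case
  proof (cases "degree p = 0")
    case True
    then have "pderiv p = 0" by (simp add: pderiv_eq_0_iff)
    moreover have "(pderiv ^^ k) (0 :: 'a poly) = 0" by (induction k) auto
    ultimately show ?thesis by (simp add: funpow_swap1)
  next
    case False
    then have "degree (pderiv p) < k" using Suc.prems by (simp add: degree_pderiv)
    then show ?thesis using Suc.IH by (simp add: funpow_swap1)
  qed
qed simp

lemma abs_diff_midrange_le:
  fixes u :: "'a \<Rightarrow> real"
  assumes "bounded (u ` S)" "x \<in> S"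
  shows "\<bar>u x - ((SUP x\<in>S. u x) + (INF x\<in>S. u x)) / 2\<bar> \<le> oscillation u S / 2"
proof -
  have "u x \<le> (SUP x\<in>S. u x)" "(INF x\<in>S. u x) \<le> u x"
    using assms bounded_imp_bdd_above bounded_imp_bdd_below
    by (auto intro!: cSUP_upper cINF_lower)
  then show ?thesis by (auto simp: oscillation_def abs_if field_simps)
qed

lemma norm_higher_deriv_le_oscillation:
  fixes p :: "complex poly"
  assumes f: "f holomorphic_on ball 0 1" and bdd: "bounded ((\<lambda>z. Re (f z)) ` ball 0 1)"
    and z: "norm z < 1" and n: "n \<ge> 1" and p: "degree p \<le> n - 1"
  shows "(1 - (norm z)\<^sup>2) ^ n * norm ((deriv ^^ n) f z) \<le> C n * oscillation (\<lambda>z. Re (f z - poly p z)) (ball 0 1)"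
proof -
  define u where "u = (\<lambda>z. Re (f z - poly p z))"
  define c where "c = ((SUP x\<in>ball 0 1. u x) + (INF x\<in>ball 0 1. u x)) / 2"
  \<comment> \<open>Subtracting the midrange \<open>c\<close> as well centres the range of the real
    part at 0. The degree stays below \<open>n\<close>, even for n = 1, so the n-th derivative of
    \<open>f\<close> is unaffected.\<close>
  define q where "q = p + [:of_real c:]"
  let ?osc = "oscillation u (ball 0 1)"
  have "compact ((\<lambda>z. Re (poly p z)) ` cball 0 1)"
    by (intro compact_continuous_image continuous_intros) auto
  then have "bounded ((\<lambda>z. Re (poly p z)) ` ball 0 1)"
    by (rule bounded_subset[OF compact_imp_bounded]) auto
  from bounded_minus_comp[OF bdd this] have "bounded (u ` ball 0 1)"
    by (simp add: u_def)
  then have le: "\<bar>u x - c\<bar> \<le> ?osc / 2" if "x \<in> ball 0 1" for x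
    unfolding c_def using that by (rule abs_diff_midrange_le)
  have osc: "?osc \<ge> 0" using order_trans[OF abs_ge_zero le[of 0]] by simp
  obtain k where k: "n = Suc k" using n by (cases n) auto
  define g where "g = (\<lambda>z. f z - poly q z)"
  have g: "g holomorphic_on ball 0 1"
    unfolding g_def using f by (intro holomorphic_intros)
  have "degree q < n"
    using p n degree_add_le[of p "n - 1" "[:of_real c:]"] by (simp add: q_def)
  then have "(deriv ^^ n) g z = (deriv ^^ n) f z"
    unfolding g_def using f z
    by (subst higher_deriv_diff[of _ "ball 0 1"])
       (auto simp: higher_deriv_poly higher_pderiv_eq_0 intro!: holomorphic_intros)
  moreover have "(1 - (norm z)\<^sup>2) ^ Suc k * norm ((deriv ^^ Suc k) g z) \<le>
      fact (Suc k) / pi * (?osc / 2 * 2 ^ Suc k * sin_moment k)"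
    by (rule norm_higher_deriv_disk_le[OF g _ z]) (use le in \<open>simp add: g_def q_def u_def algebra_simps\<close>)
  ultimately have "(1 - (norm z)\<^sup>2) ^ n * norm ((deriv ^^ n) f z) \<le>
      fact n / pi * (?osc / 2 * 2 ^ Suc k * sin_moment k)"
    by (simp only: k)
  \<comment> \<open>The half from the midrange lowers \<open>2 ^ Suc k\<close> to
    \<open>2 ^ (n - 1)\<close>.\<close>
  also have "\<dots> = (fact n * 2 ^ (n - 1) * sin_moment (n - 1)) / pi * ?osc"
    by (simp add: k)
  also have "\<dots> \<le> C n * ?osc"
    using sin_moment_le_C[OF n] osc by (intro mult_right_mono) (auto simp: field_simps)
  finally show ?thesis by (simp only: u_def)
qed

theorem theorem1p4:
  fixes n :: nat and f :: "complex \<Rightarrow> complex"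
  assumes "n \<ge> 1"
    and "f analytic_on unit_disk"
    and "bounded ((\<lambda>z. Re (f z)) ` unit_disk)"
  shows "\<forall>z\<in>unit_disk.
           norm ((deriv ^^ n) f z) \<le> C n * (1 - (norm z)\<^sup>2) powi (- int n) * poly_oscillation n f"
proof
  fix z :: complex assume "z \<in> unit_disk"
  then have z: "norm z < 1" by simp
  let ?L = "(1 - (norm z)\<^sup>2) ^ n * norm ((deriv ^^ n) f z)"
  let ?P = "{p :: complex poly. degree p \<le> n - 1}"
  have hol: "f holomorphic_on ball 0 1"
    using assms(2) by (rule analytic_imp_holomorphic)
  have le: "?L \<le> C n * oscillation (\<lambda>z. Re (f z - poly p z)) unit_disk" if "p \<in> ?P" for p
    using norm_higher_deriv_le_oscillation[OF hol assms(3) z assms(1)] that by simp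
  have pos: "1 - (norm z)\<^sup>2 > 0" using z by (simp add: abs_square_less_1)
  have "0 \<le> pi * C n"
    using sin_moment_le_C[OF assms(1)] sin_moment_nonneg[of "n - 1"]
    by (meson fact_ge_zero mult_nonneg_nonneg order_trans zero_le_numeral zero_le_power)
  then have "0 \<le> C n" by (metis pi_gt_zero zero_le_mult_iff not_le)
  \<comment> \<open>Passing to the infimum over \<open>p\<close> requires dividing by
    \<open>C n\<close>. In the case \<open>C n = 0\<close>, the bound for the single polynomial 0
    already gives the claim.\<close>
  then have "?L \<le> C n * poly_oscillation n f"
  proof (cases "C n = 0")
    case True
    then show ?thesis using le[of 0] by simp
  next
    case False
    with \<open>0 \<le> C n\<close> have "C n > 0" by simp
    have "?L / C n \<le> poly_oscillation n f"
      unfolding poly_oscillation_def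
    proof (rule cINF_greatest)
      show "?P \<noteq> {}" by (auto intro: exI[of _ 0])
    qed (use le \<open>C n > 0\<close> in \<open>simp add: field_simps\<close>)
    then show ?thesis using \<open>C n > 0\<close> by (simp add: field_simps)
  qed
  then show "norm ((deriv ^^ n) f z) \<le> C n * (1 - (norm z)\<^sup>2) powi (- int n) * poly_oscillation n f"
    using pos by (simp add: power_int_minus field_simps)
qed

end
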